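(* Let $0<\gamma\le 1$. Let $X$ be a quasi-Banach space, $Y$ a $\gamma$-Banach space and $T:X\to Y$ a bounded linear operator. Then $$2^{1-1/\gamma}\|T\| \le e_1(T)\le \|T\|,$$ and the constant $2^{1-1/\gamma}$ is sharp, i.e. for each $\gamma\in(0,1]$ it cannot be replaced by any larger constant: for every real $c>2^{1-1/\gamma}$ there exist a quasi-Banach space $X$, a $\gamma$-Banach space $Y$ and a bounded linear operator $T:X\to Y$ with $e_1(T)<c\|T\|$.
   Context: All vector spaces are real. For $\gamma\in(0,1]$, a $\gamma$-norm on a vector space $X$ is a function $\|\cdot|X\|:X\to[0,\infty)$ that vanishes only at $0$, is absolutely homogeneous, and satisfies $\|x+y|X\|^\gamma\le\|x|X\|^\gamma+\|y|X\|^\gamma$ for all $x,y\in X$. A quasi-norm is defined in the same way, with this last inequality replaced by $\|x+y|X\|\le C(\|x|X\|+\|y|X\|)$ for some constant $C\ge1$. A $\gamma$-Banach space (resp. quasi-Banach space) is a vector space that is complete with respect to a given $\gamma$-norm (resp. quasi-norm). $B_X$ denotes the closed unit ball of $X$, and $\|T\|=\sup_{x\in B_X}\|Tx|Y\|$. For a bounded linear operator $T:X\to Y$ and $k\in\mathbb N=\{1,2,\dots\}$, the $k$-th (outer) entropy number $e_k(T)$ is the infimum of all $\varepsilon>0$ such that $T(B_X)$ can be covered by $2^{k-1}$ balls $y+\varepsilon B_Y$ ($y\in Y$) in $Y$ of radius $\varepsilon$. *)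

theory Defs
  imports "HOL-Analysis.Analysis" "HOL-Analysis.Finite_Function_Topology"
begin

text \<open>
  A space is a pair of a carrier \<open>V\<close>, which is a linear subspace of some type of class
  \<open>real_vector\<close>, and a functional \<open>q\<close> on that type. Only the values of \<open>q\<close> on \<open>V\<close> matter; any
  norm or topology that the ambient type may carry is irrelevant.
\<close>

definition homogeneous_functional :: "'a::real_vector set \<Rightarrow> ('a \<Rightarrow> real) \<Rightarrow> bool" where
  "homogeneous_functional V q \<longleftrightarrow>
     (\<forall>x\<in>V. 0 \<le> q x) \<and>
     (\<forall>x\<in>V. q x = 0 \<longleftrightarrow> x = 0) \<and>
     (\<forall>x\<in>V. \<forall>a. q (a *\<^sub>R x) = \<bar>a\<bar> * q x)"

definition gamma_norm :: "real \<Rightarrow> 'a::real_vector set \<Rightarrow> ('a \<Rightarrow> real) \<Rightarrow> bool" where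
  "gamma_norm \<gamma> V q \<longleftrightarrow>
     homogeneous_functional V q \<and>
     (\<forall>x\<in>V. \<forall>y\<in>V. q (x + y) powr \<gamma> \<le> q x powr \<gamma> + q y powr \<gamma>)"

definition quasi_norm :: "'a::real_vector set \<Rightarrow> ('a \<Rightarrow> real) \<Rightarrow> bool" where
  "quasi_norm V q \<longleftrightarrow>
     homogeneous_functional V q \<and>
     (\<exists>C\<ge>1. \<forall>x\<in>V. \<forall>y\<in>V. q (x + y) \<le> C * (q x + q y))"

text \<open>
  A quasi-norm need not induce a metric, so completeness is spelled out with Cauchy sequences.
\<close>

definition complete_wrt :: "'a::real_vector set \<Rightarrow> ('a \<Rightarrow> real) \<Rightarrow> bool" where
  "complete_wrt V q \<longleftrightarrow>
     (\<forall>s. (\<forall>n. s n \<in> V) \<and> (\<forall>\<epsilon>>0. \<exists>N::nat. \<forall>m\<ge>N. \<forall>n\<ge>N. q (s m - s n) < \<epsilon>)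
        \<longrightarrow> (\<exists>x\<in>V. (\<lambda>n. q (s n - x)) \<longlonglongrightarrow> 0))"

definition gamma_Banach :: "real \<Rightarrow> 'a::real_vector set \<Rightarrow> ('a \<Rightarrow> real) \<Rightarrow> bool" where
  "gamma_Banach \<gamma> V q \<longleftrightarrow> subspace V \<and> gamma_norm \<gamma> V q \<and> complete_wrt V q"

definition quasi_Banach :: "'a::real_vector set \<Rightarrow> ('a \<Rightarrow> real) \<Rightarrow> bool" where
  "quasi_Banach V q \<longleftrightarrow> subspace V \<and> quasi_norm V q \<and> complete_wrt V q"

definition unit_ball :: "'a::real_vector set \<Rightarrow> ('a \<Rightarrow> real) \<Rightarrow> 'a set" where
  "unit_ball V q = {x\<in>V. q x \<le> 1}"

definition bounded_operator ::
  "'a::real_vector set \<Rightarrow> ('a \<Rightarrow> real) \<Rightarrow> 'b::real_vector set \<Rightarrow> ('b \<Rightarrow> real) \<Rightarrow> ('a \<Rightarrow> 'b) \<Rightarrow> bool"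
where
  "bounded_operator X qX Y qY T \<longleftrightarrow>
     (\<forall>x\<in>X. T x \<in> Y) \<and>
     (\<forall>x\<in>X. \<forall>y\<in>X. T (x + y) = T x + T y) \<and>
     (\<forall>x\<in>X. \<forall>a. T (a *\<^sub>R x) = a *\<^sub>R T x) \<and>
     (\<exists>C. \<forall>x\<in>X. qY (T x) \<le> C * qX x)"

definition operator_norm ::
  "'a::real_vector set \<Rightarrow> ('a \<Rightarrow> real) \<Rightarrow> ('b::real_vector \<Rightarrow> real) \<Rightarrow> ('a \<Rightarrow> 'b) \<Rightarrow> real"
where
  "operator_norm X qX qY T = (SUP x\<in>unit_ball X qX. qY (T x))"

text \<open>
  The \<open>2 ^ (k - 1)\<close> centres form an indexed family, so they need not be distinct.
  Only \<open>k \<ge> 1\<close> is meaningful.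
\<close>

definition entropy_number ::
  "nat \<Rightarrow> 'a::real_vector set \<Rightarrow> ('a \<Rightarrow> real) \<Rightarrow> 'b::real_vector set \<Rightarrow> ('b \<Rightarrow> real) \<Rightarrow> ('a \<Rightarrow> 'b) \<Rightarrow> real"
where
  "entropy_number k X qX Y qY T =
     Inf {\<epsilon>. \<epsilon> > 0 \<and>
       (\<exists>y :: nat \<Rightarrow> 'b. (\<forall>i < 2 ^ (k - 1). y i \<in> Y) \<and>
          T ` unit_ball X qX \<subseteq> (\<Union>i < 2 ^ (k - 1). (\<lambda>b. y i + \<epsilon> *\<^sub>R b) ` unit_ball Y qY))}"

text \<open>
  HOL cannot quantify existentially over types, so spaces that are asserted to exist are subspaces
  of one fixed ambient space: the finitely supported functions from the reals to the reals. Its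
  Hamel dimension is that of the continuum, so it contains, up to linear isomorphism, every real
  vector space of at most that dimension.
\<close>

type_synonym ambient = "real \<Rightarrow>\<^sub>0 real"

end

theory Submission
  imports Defs
begin

text \<open>
  If $T(B_X)$ lies in a ball of radius $\varepsilon$ about $y$, then so do $Tx$ and $-Tx$, and the
  $\gamma$-triangle inequality applied to $2Tx = (Tx - y) - (-Tx - y)$ gives
  $\|2Tx\|^\gamma \le 2\varepsilon^\gamma$.

  For sharpness, every nonnegative sublinear functional $g$ on $Y$ with $g(x) = g(-x) = 0$ only for
  $x = 0$ yields the $\gamma$-norm $(g(x)^\gamma + g(-x)^\gamma)^{1/\gamma}$. On the plane we take
  $g(u,w) = u^+ + w^-$. Then the segment from $(-1,-1)$ to $(1,1)$, whose endpoints have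
  $\gamma$-norm $2^{1/\gamma}$, lies in the ball of radius $2$ about $(-1,1)$: the differences
  $(t+1,t-1)$ have coordinates of opposite sign, where $g(x) = |u|+|w|$ and $g(-x) = 0$.
  The operator is $(u,w) \mapsto (u,u)$.
\<close>

section \<open>The two bounds for the first entropy number\<close>

lemma homogeneous_functional_uminus:
  assumes "homogeneous_functional V q" "x \<in> V"
  shows "q (- x) = q x"
proof -
  have "q ((-1) *\<^sub>R x) = \<bar>-1\<bar> * q x"
    using assms unfolding homogeneous_functional_def by blast
  then show ?thesis by simp
qed

text \<open>Homogeneity lets \<open>z - y\<close> be rescaled by \<open>1 / \<epsilon>\<close> into
  the unit ball; from here on, coverings are handled through inequalities instead of images of
  \<open>unit_ball\<close>.\<close>

lemma mem_ball_iff: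
  assumes V: "subspace V" and q: "homogeneous_functional V q" and "y \<in> V" "\<epsilon> > 0"
  shows "z \<in> (\<lambda>b. y + \<epsilon> *\<^sub>R b) ` unit_ball V q \<longleftrightarrow> z \<in> V \<and> q (z - y) \<le> \<epsilon>"
proof
  assume "z \<in> (\<lambda>b. y + \<epsilon> *\<^sub>R b) ` unit_ball V q"
  then obtain b where b: "b \<in> V" "q b \<le> 1" "z = y + \<epsilon> *\<^sub>R b"
    by (auto simp: unit_ball_def)
  have "q (z - y) = \<epsilon> * q b"
    using b q \<open>\<epsilon> > 0\<close> by (simp add: homogeneous_functional_def)
  with b \<open>\<epsilon> > 0\<close> \<open>y \<in> V\<close> V show "z \<in> V \<and> q (z - y) \<le> \<epsilon>"
    by (simp add: subspace_add subspace_scale mult_left_le)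
next
  assume z: "z \<in> V \<and> q (z - y) \<le> \<epsilon>"
  define b where "b = (1 / \<epsilon>) *\<^sub>R (z - y)"
  have "z - y \<in> V"
    using z \<open>y \<in> V\<close> V by (simp add: subspace_diff)
  then have "b \<in> V" "q b = q (z - y) / \<epsilon>"
    using q V \<open>\<epsilon> > 0\<close> unfolding b_def homogeneous_functional_def by (auto simp: subspace_scale)
  then have "b \<in> unit_ball V q"
    using z \<open>\<epsilon> > 0\<close> by (simp add: unit_ball_def)
  moreover have "z = y + \<epsilon> *\<^sub>R b"
    using \<open>\<epsilon> > 0\<close> by (simp add: b_def)
  ultimately show "z \<in> (\<lambda>b. y + \<epsilon> *\<^sub>R b) ` unit_ball V q"
    by blast
qed

text \<open>For \<open>k = 1\<close> the index set \<open>i < 2 ^ (1 - 1)\<close> contains only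
  \<open>0\<close>, so a covering amounts to one centre.\<close>

lemma entropy_number_1:
  assumes Y: "subspace Y" and q: "homogeneous_functional Y qY" and T: "\<And>x. x \<in> X \<Longrightarrow> T x \<in> Y"
  shows "entropy_number 1 X qX Y qY T =
    Inf {\<epsilon>. \<epsilon> > 0 \<and> (\<exists>y\<in>Y. \<forall>x\<in>unit_ball X qX. qY (T x - y) \<le> \<epsilon>)}"
proof -
  have "(\<exists>y :: nat \<Rightarrow> _. (\<forall>i < 2 ^ (1 - 1). y i \<in> Y) \<and>
          T ` unit_ball X qX \<subseteq> (\<Union>i < 2 ^ (1 - 1). (\<lambda>b. y i + \<epsilon> *\<^sub>R b) ` unit_ball Y qY))
      \<longleftrightarrow> (\<exists>y\<in>Y. \<forall>x\<in>unit_ball X qX. qY (T x - y) \<le> \<epsilon>)" (is "?L \<longleftrightarrow> ?R") if "\<epsilon> > 0" for \<epsilon>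
  proof
    assume ?L
    then obtain y :: "nat \<Rightarrow> _" where y: "y 0 \<in> Y"
      "T ` unit_ball X qX \<subseteq> (\<lambda>b. y 0 + \<epsilon> *\<^sub>R b) ` unit_ball Y qY"
      by (auto simp: lessThan_Suc)
    then have "\<forall>x\<in>unit_ball X qX. qY (T x - y 0) \<le> \<epsilon>"
      using mem_ball_iff[OF Y q y(1) that] by blast
    with y show ?R by blast
  next
    assume ?R
    then obtain y where y: "y \<in> Y" "\<forall>x\<in>unit_ball X qX. qY (T x - y) \<le> \<epsilon>"
      by blast
    then have "T ` unit_ball X qX \<subseteq> (\<lambda>b. y + \<epsilon> *\<^sub>R b) ` unit_ball Y qY"
      using mem_ball_iff[OF Y q y(1) that] T by (auto simp: unit_ball_def)
    with y show ?L
      by (intro exI[of _ "\<lambda>_. y"]) (simp add: lessThan_Suc)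
  qed
  then show ?thesis
    unfolding entropy_number_def by (intro arg_cong[where f = Inf] Collect_cong conj_cong refl)
qed

text \<open>A real \<open>SUP\<close> dominates the individual values only when these are bounded
  above; this fact makes \<open>operator_norm\<close> usable through
  \<open>cSUP_upper\<close>.\<close>

lemma bdd_above_operator_norm:
  assumes "homogeneous_functional X qX" "bounded_operator X qX Y qY T"
  shows "bdd_above ((\<lambda>x. qY (T x)) ` unit_ball X qX)"
proof -
  obtain C where C: "\<forall>x\<in>X. qY (T x) \<le> C * qX x"
    using assms(2) unfolding bounded_operator_def by blast
  \<comment> \<open>The constant in \<open>bounded_operator\<close> may be negative, hence the
    absolute value.\<close>
  have "qY (T x) \<le> \<bar>C\<bar>" if "x \<in> unit_ball X qX" for x
  proof -
    have x: "x \<in> X" "0 \<le> qX x" "qX x \<le> 1"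
      using that assms(1) by (auto simp: unit_ball_def homogeneous_functional_def)
    have "qY (T x) \<le> C * qX x" using C x by blast
    also have "\<dots> \<le> \<bar>C\<bar> * qX x" using x by (intro mult_right_mono) auto
    also have "\<dots> \<le> \<bar>C\<bar>" using x by (simp add: mult_left_le)
    finally show ?thesis .
  qed
  then show ?thesis by (rule bdd_aboveI2)
qed

lemma gamma_norm_le_covering_radius:
  assumes \<gamma>: "0 < \<gamma>" and V: "subspace V" and q: "gamma_norm \<gamma> V q"
    and v: "v \<in> V" and y: "y \<in> V" and le: "q (v - y) \<le> \<epsilon>" "q (- v - y) \<le> \<epsilon>"
  shows "2 powr (1 - 1 / \<gamma>) * q v \<le> \<epsilon>"
proof -
  have hom: "homogeneous_functional V q"
    using q by (simp add: gamma_norm_def)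
  have mem: "v - y \<in> V" "- v - y \<in> V" "v + y \<in> V"
    using V v y by (auto simp: subspace_diff subspace_neg subspace_add)
  \<comment> \<open>Evenness reads the bound at \<open>- v\<close> as a bound for
    \<open>v + y\<close>, so both summands of \<open>2 *\<^sub>R v = (v - y) + (v + y)\<close> have
    \<open>q\<close>-value at most \<epsilon>.\<close>
  have neg: "q (v + y) = q (- v - y)"
    using homogeneous_functional_uminus[OF hom mem(3)] by simp
  have nonneg: "0 \<le> q (v - y)" "0 \<le> q (v + y)" "0 \<le> q v"
    using hom mem v by (auto simp: homogeneous_functional_def)
  then have "0 \<le> \<epsilon>" using le by linarith
  have "q (2 *\<^sub>R v) = 2 * q v"
    using hom v by (simp add: homogeneous_functional_def)
  moreover have "2 *\<^sub>R v = (v - y) + (v + y)"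
    by (simp add: scaleR_2)
  ultimately have "(2 * q v) powr \<gamma> \<le> q (v - y) powr \<gamma> + q (v + y) powr \<gamma>"
    using q mem unfolding gamma_norm_def by metis
  also have "\<dots> \<le> \<epsilon> powr \<gamma> + \<epsilon> powr \<gamma>"
    using le nonneg neg \<gamma> by (intro add_mono powr_mono2) auto
  finally have "(2 * q v) powr \<gamma> \<le> 2 * \<epsilon> powr \<gamma>" by simp
  then have "((2 * q v) powr \<gamma>) powr (1 / \<gamma>) \<le> (2 * \<epsilon> powr \<gamma>) powr (1 / \<gamma>)"
    using \<gamma> by (intro powr_mono2) auto
  \<comment> \<open>Taking the \<gamma>-th root leaves the factor
    \<open>2 powr (1 / \<gamma>)\<close>; dividing it by the 2 of \<open>2 *\<^sub>R v\<close>
    produces the reciprocal of the constant in the claim.\<close>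
  then have "2 * q v \<le> 2 powr (1 / \<gamma>) * \<epsilon>"
    using \<gamma> nonneg \<open>0 \<le> \<epsilon>\<close> by (simp add: powr_powr powr_mult)
  then show ?thesis
    by (simp add: powr_diff field_simps)
qed

lemma entropy_number_1_bounds:
  assumes \<gamma>: "0 < \<gamma>" and X: "quasi_Banach X qX" and Y: "gamma_Banach \<gamma> Y qY"
    and T: "bounded_operator X qX Y qY T"
  shows "2 powr (1 - 1 / \<gamma>) * operator_norm X qX qY T \<le> entropy_number 1 X qX Y qY T"
    and "entropy_number 1 X qX Y qY T \<le> operator_norm X qX qY T"
proof -
  have sX: "subspace X" and hX: "homogeneous_functional X qX"
    using X by (auto simp: quasi_Banach_def quasi_norm_def)
  have sY: "subspace Y" and gY: "gamma_norm \<gamma> Y qY" and hY: "homogeneous_functional Y qY"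
    using Y by (auto simp: gamma_Banach_def gamma_norm_def)
  have TY: "T x \<in> Y" if "x \<in> X" for x
    using T that by (simp add: bounded_operator_def)
  have T_scale: "T (a *\<^sub>R x) = a *\<^sub>R T x" if "x \<in> X" for a x
    using T that by (simp add: bounded_operator_def)
  let ?B = "unit_ball X qX" and ?N = "operator_norm X qX qY T"
  define S where "S = {\<epsilon>. \<epsilon> > 0 \<and> (\<exists>y\<in>Y. \<forall>x\<in>?B. qY (T x - y) \<le> \<epsilon>)}"
  have e: "entropy_number 1 X qX Y qY T = Inf S"
    unfolding S_def using TY by (rule entropy_number_1[OF sY hY])
  have "qX 0 = 0"
    using subspace_0[OF sX] hX unfolding homogeneous_functional_def by blast
  \<comment> \<open>This makes the supremum one over a nonempty set and yields
    \<open>0 \<le> ?N\<close>.\<close>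
  then have zero: "0 \<in> ?B"
    using subspace_0[OF sX] by (simp add: unit_ball_def)
  have upper: "qY (T x) \<le> ?N" if "x \<in> ?B" for x
    unfolding operator_norm_def using that bdd_above_operator_norm[OF hX T] by (rule cSUP_upper)
  have "0 \<le> qY (T 0)"
    using TY[OF subspace_0[OF sX]] hY by (simp add: homogeneous_functional_def)
  then have N0: "0 \<le> ?N"
    using upper[OF zero] by linarith
  \<comment> \<open>The centre 0 works. The inequality is strict because \<open>?N\<close> may be 0,
    which is not an admissible radius; the upper bound is therefore obtained through
    \<open>dense_ge\<close> from all larger radii.\<close>
  have mem: "\<epsilon> \<in> S" if "?N < \<epsilon>" for \<epsilon>
  proof -
    have "\<forall>x\<in>?B. qY (T x - 0) \<le> \<epsilon>"
      using upper that by fastforce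
    then show ?thesis
      unfolding S_def using that N0 subspace_0[OF sY] by (auto intro!: bexI[of _ 0])
  qed
  have bdd: "bdd_below S"
    unfolding S_def by (intro bdd_belowI[of _ 0]) auto
  show "entropy_number 1 X qX Y qY T \<le> ?N"
    unfolding e by (rule dense_ge) (rule cInf_lower[OF mem bdd])
  have "S \<noteq> {}"
    using mem[of "?N + 1"] by auto
  moreover have "2 powr (1 - 1 / \<gamma>) * ?N \<le> \<epsilon>" if "\<epsilon> \<in> S" for \<epsilon>
  proof -
    obtain y where y: "y \<in> Y" "\<And>x. x \<in> ?B \<Longrightarrow> qY (T x - y) \<le> \<epsilon>"
      using \<open>\<epsilon> \<in> S\<close> unfolding S_def by blast
    have "qY (T x) \<le> \<epsilon> / 2 powr (1 - 1 / \<gamma>)" if x: "x \<in> ?B" for x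
    proof -
      have xX: "x \<in> X" using x by (simp add: unit_ball_def)
      then have "- x \<in> ?B"
        using x homogeneous_functional_uminus[OF hX xX] sX by (simp add: unit_ball_def subspace_neg)
      moreover have "T (- x) = - T x"
        using T_scale[OF xX, of "-1"] by simp
      ultimately have "2 powr (1 - 1 / \<gamma>) * qY (T x) \<le> \<epsilon>"
        using y(2)[OF x] y(2)[of "- x"]
        by (intro gamma_norm_le_covering_radius[OF \<gamma> sY gY TY[OF xX] y(1)]) auto
      then show ?thesis by (simp add: field_simps)
    qed
    then have "?N \<le> \<epsilon> / 2 powr (1 - 1 / \<gamma>)"
      unfolding operator_norm_def using zero by (intro cSUP_least) auto
    then show ?thesis by (simp add: field_simps)
  qed
  ultimately show "2 powr (1 - 1 / \<gamma>) * ?N \<le> entropy_number 1 X qX Y qY T"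
    unfolding e by (rule cInf_greatest)
qed

section \<open>Gamma-norms from sublinear functionals\<close>

text \<open>After division by \<open>a + b\<close> the two summands are numbers in [0,1] with sum 1,
  and \<open>t \<le> t powr \<gamma>\<close> holds on that interval.\<close>

lemma powr_add_le:
  fixes a b \<gamma> :: real
  assumes "0 \<le> a" "0 \<le> b" "0 < \<gamma>" "\<gamma> \<le> 1"
  shows "(a + b) powr \<gamma> \<le> a powr \<gamma> + b powr \<gamma>"
proof (cases "a + b = 0")
  case False
  then have pos: "0 < a + b" using assms by linarith
  have *: "t \<le> t powr \<gamma>" if "0 \<le> t" "t \<le> 1" for t :: real
    using powr_mono'[of \<gamma> 1 t] that assms by simp
  have "1 = a / (a + b) + b / (a + b)"
    using pos by (simp add: add_divide_distrib[symmetric])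
  also have "\<dots> \<le> (a / (a + b)) powr \<gamma> + (b / (a + b)) powr \<gamma>"
    using pos assms by (intro add_mono *) auto
  also have "\<dots> = (a powr \<gamma> + b powr \<gamma>) / (a + b) powr \<gamma>"
    by (simp add: powr_divide add_divide_distrib)
  finally show ?thesis using pos by (simp add: field_simps)
qed (use assms in auto)

text \<open>The l_\<gamma> length of the pair \<open>(g x, g (- x))\<close>. It equals
  \<open>g x\<close> where \<open>g (- x) = 0\<close>, but exceeds \<open>g x\<close> by the factor
  \<open>2 powr (1 / \<gamma>)\<close> where both entries agree; sharpness exploits this
  gap.\<close>

definition symmetrization :: "real \<Rightarrow> ('a::real_vector \<Rightarrow> real) \<Rightarrow> 'a \<Rightarrow> real" where
  "symmetrization \<gamma> g x = (g x powr \<gamma> + g (- x) powr \<gamma>) powr (1 / \<gamma>)"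

lemma symmetrization_powr: "0 < \<gamma> \<Longrightarrow> symmetrization \<gamma> g x powr \<gamma> = g x powr \<gamma> + g (- x) powr \<gamma>"
  by (simp add: symmetrization_def powr_powr)

lemma symmetrization_eq_left:
  assumes "0 < \<gamma>" "0 \<le> g x" "g (- x) = 0"
  shows "symmetrization \<gamma> g x = g x"
  using assms by (simp add: symmetrization_def powr_powr)

text \<open>This bound and the next one compare the symmetrization with the larger of
  \<open>g x\<close> and \<open>g (- x)\<close>; completeness of the example rests on that
  comparison.\<close>

lemma symmetrization_upper:
  assumes "0 < \<gamma>" "0 \<le> g x" "g x \<le> m" "0 \<le> g (- x)" "g (- x) \<le> m"
  shows "symmetrization \<gamma> g x \<le> 2 powr (1 / \<gamma>) * m"
proof -
  have "symmetrization \<gamma> g x \<le> (m powr \<gamma> + m powr \<gamma>) powr (1 / \<gamma>)"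
    unfolding symmetrization_def using assms by (intro powr_mono2 add_mono) auto
  also have "\<dots> = 2 powr (1 / \<gamma>) * m"
    using assms by (simp add: powr_mult powr_powr flip: mult_2)
  finally show ?thesis .
qed

lemma symmetrization_lower:
  assumes "0 < \<gamma>" "0 \<le> g x" "0 \<le> g (- x)"
  shows "max (g x) (g (- x)) \<le> symmetrization \<gamma> g x"
proof -
  have "g x = (g x powr \<gamma>) powr (1 / \<gamma>)" "g (- x) = (g (- x) powr \<gamma>) powr (1 / \<gamma>)"
    using assms by (simp_all add: powr_powr)
  moreover have "(g x powr \<gamma>) powr (1 / \<gamma>) \<le> symmetrization \<gamma> g x"
    "(g (- x) powr \<gamma>) powr (1 / \<gamma>) \<le> symmetrization \<gamma> g x"
    unfolding symmetrization_def using assms by (auto intro!: powr_mono2)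
  ultimately show ?thesis by simp
qed

text \<open>The \<gamma>-th power of the symmetrization is a sum of two terms, each subadditive
  because \<open>g\<close> is and because \<open>powr_add_le\<close> holds for the \<gamma>-th
  power.\<close>

lemma gamma_norm_symmetrization:
  assumes \<gamma>: "0 < \<gamma>" "\<gamma> \<le> 1" and V: "subspace V"
    and nonneg: "\<And>x. 0 \<le> g x"
    and add: "\<And>x y. g (x + y) \<le> g x + g y"
    and scale: "\<And>a x. 0 \<le> a \<Longrightarrow> g (a *\<^sub>R x) = a * g x"
    and definite: "\<And>x. x \<in> V \<Longrightarrow> g x = 0 \<Longrightarrow> g (- x) = 0 \<Longrightarrow> x = 0"
  shows "gamma_norm \<gamma> V (symmetrization \<gamma> g)"
proof -
  let ?q = "symmetrization \<gamma> g"
  have pos_scale: "?q (a *\<^sub>R x) = a * ?q x" if "0 \<le> a" for a x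
  proof -
    have "g (- (a *\<^sub>R x)) = a * g (- x)"
      using scale[OF that, of "- x"] by simp
    then have "g (a *\<^sub>R x) powr \<gamma> + g (- (a *\<^sub>R x)) powr \<gamma> = a powr \<gamma> * (g x powr \<gamma> + g (- x) powr \<gamma>)"
      using that by (simp add: scale powr_mult distrib_left)
    then show ?thesis
      unfolding symmetrization_def using that \<gamma> by (simp add: powr_mult powr_powr)
  qed
  have even: "?q (- x) = ?q x" for x
    by (simp add: symmetrization_def add.commute)
  \<comment> \<open>For negative \<open>a\<close>, \<open>\<bar>a\<bar> *\<^sub>R x\<close> is the
    negative of \<open>a *\<^sub>R x\<close>, so evenness extends positive homogeneity to all
    scalars.\<close>
  have scale_q: "?q (a *\<^sub>R x) = \<bar>a\<bar> * ?q x" for a x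
    using pos_scale[of "\<bar>a\<bar>" x] even[of "a *\<^sub>R x"] by (cases "0 \<le> a") auto
  have zero: "?q x = 0 \<longleftrightarrow> x = 0" if "x \<in> V" for x
  proof
    assume "?q x = 0"
    then have "g x = 0" "g (- x) = 0"
      using symmetrization_lower[of \<gamma> g x] \<gamma> nonneg[of x] nonneg[of "- x"] by auto
    then show "x = 0" using definite that by blast
  next
    assume "x = 0"
    then show "?q x = 0" using scale_q[of 0 x] by simp
  qed
  have triangle: "?q (x + y) powr \<gamma> \<le> ?q x powr \<gamma> + ?q y powr \<gamma>" for x y
  proof -
    have *: "g (x + y) powr \<gamma> \<le> g x powr \<gamma> + g y powr \<gamma>" for x y
    proof -
      have "g (x + y) powr \<gamma> \<le> (g x + g y) powr \<gamma>"
        using \<gamma> nonneg add by (intro powr_mono2) auto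
      also have "\<dots> \<le> g x powr \<gamma> + g y powr \<gamma>"
        using \<gamma> nonneg by (intro powr_add_le)
      finally show ?thesis .
    qed
    show ?thesis
      using *[of x y] *[of "- x" "- y"] \<gamma> by (simp add: symmetrization_powr)
  qed
  show ?thesis
    unfolding gamma_norm_def homogeneous_functional_def
    using scale_q zero triangle by (auto simp: symmetrization_def)
qed

section \<open>The extremal example\<close>

definition plane :: "ambient set" where
  "plane = {z. \<forall>i. i \<noteq> 0 \<longrightarrow> i \<noteq> 1 \<longrightarrow> Poly_Mapping.lookup z i = 0}"

definition vec2 :: "real \<Rightarrow> real \<Rightarrow> ambient" where
  "vec2 u w = Poly_Mapping.single 0 u + Poly_Mapping.single 1 w"

abbreviation crd0 :: "ambient \<Rightarrow> real" where "crd0 z \<equiv> Poly_Mapping.lookup z 0"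
abbreviation crd1 :: "ambient \<Rightarrow> real" where "crd1 z \<equiv> Poly_Mapping.lookup z 1"

text \<open>Scaling does not enlarge the support, so the scaled function is again finitely supported
  and its values can be read off.\<close>

lemma lookup_scaleR: "Poly_Mapping.lookup (a *\<^sub>R z) i = a *\<^sub>R Poly_Mapping.lookup z i"
  for z :: "'i \<Rightarrow>\<^sub>0 'b::real_vector"
proof -
  have "{i. a *\<^sub>R Poly_Mapping.lookup z i \<noteq> 0} \<subseteq> {i. Poly_Mapping.lookup z i \<noteq> 0}"
    by auto
  then have "finite {i. a *\<^sub>R Poly_Mapping.lookup z i \<noteq> 0}"
    by (rule finite_subset) simp
  then show ?thesis
    by (simp add: scaleR_poly_mapping_def)
qed

lemma crd_vec2 [simp]: "crd0 (vec2 u w) = u" "crd1 (vec2 u w) = w"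
  by (simp_all add: vec2_def lookup_add lookup_single)

lemma vec2_in_plane [simp]: "vec2 u w \<in> plane"
  by (simp add: vec2_def plane_def lookup_add lookup_single)

lemma plane_eqI: "x \<in> plane \<Longrightarrow> y \<in> plane \<Longrightarrow> crd0 x = crd0 y \<Longrightarrow> crd1 x = crd1 y \<Longrightarrow> x = y"
  unfolding plane_def by (intro poly_mapping_eqI) (metis (mono_tags, lifting) mem_Collect_eq)

lemma subspace_plane: "subspace plane"
  by (auto simp: subspace_def plane_def lookup_add lookup_scaleR)

text \<open>The lower bounds pass the Cauchy property to both coordinates, which converge in the
  reals; the upper bound turns coordinatewise convergence back into convergence for
  \<open>q\<close>.\<close>

lemma complete_wrt_plane:
  assumes lower: "\<And>z. \<bar>crd0 z\<bar> \<le> q z" "\<And>z. \<bar>crd1 z\<bar> \<le> q z"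
    and upper: "\<And>z. q z \<le> C * (\<bar>crd0 z\<bar> + \<bar>crd1 z\<bar>)"
  shows "complete_wrt plane q"
  unfolding complete_wrt_def
proof (intro allI impI, elim conjE)
  fix s :: "nat \<Rightarrow> ambient"
  assume "\<forall>\<epsilon>>0. \<exists>N. \<forall>m\<ge>N. \<forall>n\<ge>N. q (s m - s n) < \<epsilon>"
  then have "Cauchy (\<lambda>n. crd0 (s n))" "Cauchy (\<lambda>n. crd1 (s n))"
    unfolding Cauchy_def dist_real_def lookup_minus[symmetric]
    by (meson lower order_le_less_trans)+
  then obtain u w where u: "(\<lambda>n. crd0 (s n)) \<longlonglongrightarrow> u" and w: "(\<lambda>n. crd1 (s n)) \<longlonglongrightarrow> w"
    by (auto simp: Cauchy_convergent_iff convergent_def)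
  have "(\<lambda>n. C * (\<bar>crd0 (s n) - u\<bar> + \<bar>crd1 (s n) - w\<bar>)) \<longlonglongrightarrow> C * (\<bar>u - u\<bar> + \<bar>w - w\<bar>)"
    by (intro tendsto_intros u w)
  then have lim: "(\<lambda>n. C * (\<bar>crd0 (s n) - u\<bar> + \<bar>crd1 (s n) - w\<bar>)) \<longlonglongrightarrow> 0"
    by simp
  have "(\<lambda>n. q (s n - vec2 u w)) \<longlonglongrightarrow> 0"
  proof (rule tendsto_sandwich[OF _ _ tendsto_const lim])
    show "\<forall>\<^sub>F n in sequentially. 0 \<le> q (s n - vec2 u w)"
      using lower(1) by (intro always_eventually allI) (meson abs_ge_zero order_trans)
    show "\<forall>\<^sub>F n in sequentially. q (s n - vec2 u w) \<le> C * (\<bar>crd0 (s n) - u\<bar> + \<bar>crd1 (s n) - w\<bar>)"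
      by (intro always_eventually allI) (use upper[of "s _ - vec2 u w"] in \<open>simp add: lookup_minus\<close>)
  qed
  then show "\<exists>x\<in>plane. (\<lambda>n. q (s n - x)) \<longlonglongrightarrow> 0"
    using vec2_in_plane by blast
qed

section \<open>The norm on the domain and the \<gamma>-norm on the target\<close>

definition l1_norm :: "ambient \<Rightarrow> real" where
  "l1_norm z = \<bar>crd0 z\<bar> + \<bar>crd1 z\<bar>"

definition mixed_part :: "ambient \<Rightarrow> real" where
  "mixed_part z = max (crd0 z) 0 + max (- crd1 z) 0"

lemma quasi_Banach_l1: "quasi_Banach plane l1_norm"
  unfolding quasi_Banach_def
proof (intro conjI)
  have "l1_norm z = 0 \<longleftrightarrow> z = 0" if "z \<in> plane" for z
    using plane_eqI[OF that subspace_0[OF subspace_plane]] by (auto simp: l1_norm_def)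
  then have "homogeneous_functional plane l1_norm"
    unfolding homogeneous_functional_def
    by (auto simp: l1_norm_def lookup_scaleR abs_mult distrib_left)
  moreover have "l1_norm (x + y) \<le> 1 * (l1_norm x + l1_norm y)" for x y
    by (simp add: l1_norm_def lookup_add)
  ultimately show "quasi_norm plane l1_norm"
    unfolding quasi_norm_def by blast
  show "complete_wrt plane l1_norm"
    by (rule complete_wrt_plane[where C = 1]) (auto simp: l1_norm_def)
qed (rule subspace_plane)

lemma gamma_Banach_mixed:
  assumes "0 < \<gamma>" "\<gamma> \<le> 1"
  shows "gamma_Banach \<gamma> plane (symmetrization \<gamma> mixed_part)"
  unfolding gamma_Banach_def
proof (intro conjI)
  have nonneg: "0 \<le> mixed_part z" for z
    by (simp add: mixed_part_def)
  show "gamma_norm \<gamma> plane (symmetrization \<gamma> mixed_part)"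
  proof (rule gamma_norm_symmetrization[OF assms subspace_plane nonneg])
    show "mixed_part (x + y) \<le> mixed_part x + mixed_part y" for x y
      by (simp add: mixed_part_def lookup_add)
    show "mixed_part (a *\<^sub>R x) = a * mixed_part x" if "0 \<le> a" for a x
      using that max_mult_distrib_left[of a "crd0 x" 0] max_mult_distrib_left[of a "- crd1 x" 0]
      by (simp add: mixed_part_def lookup_scaleR distrib_left)
    \<comment> \<open>The first equation forces \<open>crd0 x \<le> 0 \<le> crd1 x\<close>, the
      second the reverse inequalities.\<close>
    show "x = 0" if "x \<in> plane" "mixed_part x = 0" "mixed_part (- x) = 0" for x
      using that plane_eqI[OF that(1) subspace_0[OF subspace_plane]]
      by (auto simp: mixed_part_def max_def split: if_splits)
  qed
  show "complete_wrt plane (symmetrization \<gamma> mixed_part)"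
  proof (rule complete_wrt_plane[where C = "2 powr (1 / \<gamma>)"])
    fix z
    have lower: "max (mixed_part z) (mixed_part (- z)) \<le> symmetrization \<gamma> mixed_part z"
      using assms nonneg by (intro symmetrization_lower)
    \<comment> \<open>The positive and negative parts of each coordinate occur one in
      \<open>mixed_part z\<close> and the other in \<open>mixed_part (- z)\<close>.\<close>
    have "\<bar>crd0 z\<bar> \<le> max (mixed_part z) (mixed_part (- z))"
      "\<bar>crd1 z\<bar> \<le> max (mixed_part z) (mixed_part (- z))"
      by (auto simp: mixed_part_def)
    with lower show "\<bar>crd0 z\<bar> \<le> symmetrization \<gamma> mixed_part z"
      "\<bar>crd1 z\<bar> \<le> symmetrization \<gamma> mixed_part z"
      by linarith+
    show "symmetrization \<gamma> mixed_part z \<le> 2 powr (1 / \<gamma>) * (\<bar>crd0 z\<bar> + \<bar>crd1 z\<bar>)"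
      using assms by (intro symmetrization_upper nonneg) (auto simp: mixed_part_def)
  qed
qed (rule subspace_plane)

section \<open>The extremal operator, its norm and its first entropy number\<close>

definition diagonal_map :: "ambient \<Rightarrow> ambient" where
  "diagonal_map z = vec2 (crd0 z) (crd0 z)"

lemma symmetrization_diagonal:
  assumes "0 < \<gamma>"
  shows "symmetrization \<gamma> mixed_part (diagonal_map z) = 2 powr (1 / \<gamma>) * \<bar>crd0 z\<bar>"
proof -
  \<comment> \<open>With equal coordinates, positive and negative part of one number add up to its
    absolute value, at the point and at its negative alike. The resulting factor
    \<open>2 powr (1 / \<gamma>)\<close> is the largest that \<open>symmetrization_upper\<close>
    permits.\<close>
  have "mixed_part (diagonal_map z) = \<bar>crd0 z\<bar>" "mixed_part (- diagonal_map z) = \<bar>crd0 z\<bar>"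
    by (auto simp: mixed_part_def diagonal_map_def)
  then show ?thesis
    using assms by (simp add: symmetrization_def powr_mult powr_powr flip: mult_2)
qed

lemma bounded_operator_diagonal:
  assumes "0 < \<gamma>"
  shows "bounded_operator plane l1_norm plane (symmetrization \<gamma> mixed_part) diagonal_map"
  unfolding bounded_operator_def
proof (intro conjI ballI allI)
  show "diagonal_map x \<in> plane" for x
    by (simp add: diagonal_map_def)
  show "diagonal_map (x + y) = diagonal_map x + diagonal_map y" for x y
    unfolding diagonal_map_def
    by (rule plane_eqI) (auto simp: lookup_add subspace_add[OF subspace_plane])
  show "diagonal_map (a *\<^sub>R x) = a *\<^sub>R diagonal_map x" for a x
    unfolding diagonal_map_def
    by (rule plane_eqI) (auto simp: lookup_scaleR subspace_scale[OF subspace_plane])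
  show "\<exists>C. \<forall>x\<in>plane. symmetrization \<gamma> mixed_part (diagonal_map x) \<le> C * l1_norm x"
    using symmetrization_diagonal[OF assms]
    by (intro exI[of _ "2 powr (1 / \<gamma>)"]) (simp add: l1_norm_def)
qed

text \<open>The vector \<open>vec2 1 0\<close> is sent to the endpoint (1,1) of the segment. A lower
  estimate suffices, as the norm stands on the larger side of the sharpness inequality.\<close>

lemma operator_norm_diagonal:
  assumes "0 < \<gamma>"
  shows "2 powr (1 / \<gamma>) \<le> operator_norm plane l1_norm (symmetrization \<gamma> mixed_part) diagonal_map"
proof -
  have "homogeneous_functional plane l1_norm"
    using quasi_Banach_l1 by (simp add: quasi_Banach_def quasi_norm_def)
  moreover have "vec2 1 0 \<in> unit_ball plane l1_norm"
    by (simp add: unit_ball_def l1_norm_def)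
  ultimately have "symmetrization \<gamma> mixed_part (diagonal_map (vec2 1 0))
      \<le> operator_norm plane l1_norm (symmetrization \<gamma> mixed_part) diagonal_map"
    unfolding operator_norm_def
    using bdd_above_operator_norm bounded_operator_diagonal[OF assms] by (intro cSUP_upper) blast+
  then show ?thesis
    by (simp add: symmetrization_diagonal[OF assms])
qed

lemma entropy_number_diagonal:
  assumes "0 < \<gamma>" "\<gamma> \<le> 1"
  shows "entropy_number 1 plane l1_norm plane (symmetrization \<gamma> mixed_part) diagonal_map \<le> 2"
proof -
  let ?q = "symmetrization \<gamma> mixed_part"
  have hom: "homogeneous_functional plane ?q"
    using gamma_Banach_mixed[OF assms] by (simp add: gamma_Banach_def gamma_norm_def)
  have T: "diagonal_map x \<in> plane" for x
    by (simp add: diagonal_map_def)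
  have "?q (diagonal_map x - vec2 (-1) 1) \<le> 2" if "x \<in> unit_ball plane l1_norm" for x
  proof -
    let ?d = "diagonal_map x - vec2 (-1) 1"
    have "\<bar>crd0 x\<bar> \<le> 1"
      using that by (auto simp: unit_ball_def l1_norm_def)
    \<comment> \<open>With \<open>t = crd0 x\<close> the coordinates of \<open>?d\<close> satisfy
      \<open>t + 1 \<ge> 0 \<ge> t - 1\<close>, and \<open>(t + 1) + (1 - t) = 2\<close> for every
      t: all points of the segment are equally far from the centre.\<close>
    then have "mixed_part ?d = 2" "mixed_part (- ?d) = 0"
      by (auto simp: mixed_part_def diagonal_map_def lookup_minus)
    then show ?thesis
      using assms by (simp add: symmetrization_eq_left)
  qed
  then have "2 \<in> {\<epsilon>. \<epsilon> > 0 \<and> (\<exists>y\<in>plane. \<forall>x\<in>unit_ball plane l1_norm. ?q (diagonal_map x - y) \<le> \<epsilon>)}"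
    by (auto intro!: bexI[of _ "vec2 (-1) 1"])
  moreover have "bdd_below {\<epsilon>. \<epsilon> > 0 \<and> (\<exists>y\<in>plane. \<forall>x\<in>unit_ball plane l1_norm. ?q (diagonal_map x - y) \<le> \<epsilon>)}"
    by (intro bdd_belowI[of _ 0]) auto
  ultimately show ?thesis
    unfolding entropy_number_1[OF subspace_plane hom T] by (rule cInf_lower)
qed

theorem theorem3:
  fixes \<gamma> :: real
  assumes "0 < \<gamma>" and "\<gamma> \<le> 1"
  shows
    "(\<forall>(X :: 'a::real_vector set) qX (Y :: 'b::real_vector set) qY T.
        quasi_Banach X qX \<and> gamma_Banach \<gamma> Y qY \<and> bounded_operator X qX Y qY T \<longrightarrow>
          2 powr (1 - 1 / \<gamma>) * operator_norm X qX qY T \<le> entropy_number 1 X qX Y qY T \<and>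
          entropy_number 1 X qX Y qY T \<le> operator_norm X qX qY T) \<and>
     (\<forall>c > 2 powr (1 - 1 / \<gamma>).
        \<exists>(X :: ambient set) qX (Y :: ambient set) qY T.
          quasi_Banach X qX \<and> gamma_Banach \<gamma> Y qY \<and> bounded_operator X qX Y qY T \<and>
          entropy_number 1 X qX Y qY T < c * operator_norm X qX qY T)"
proof (intro conjI)
  show "\<forall>(X :: 'a set) qX (Y :: 'b set) qY T.
      quasi_Banach X qX \<and> gamma_Banach \<gamma> Y qY \<and> bounded_operator X qX Y qY T \<longrightarrow>
        2 powr (1 - 1 / \<gamma>) * operator_norm X qX qY T \<le> entropy_number 1 X qX Y qY T \<and>
        entropy_number 1 X qX Y qY T \<le> operator_norm X qX qY T"
    using entropy_number_1_bounds[OF \<open>0 < \<gamma>\<close>] by blast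
  show "\<forall>c > 2 powr (1 - 1 / \<gamma>).
      \<exists>(X :: ambient set) qX (Y :: ambient set) qY T.
        quasi_Banach X qX \<and> gamma_Banach \<gamma> Y qY \<and> bounded_operator X qX Y qY T \<and>
        entropy_number 1 X qX Y qY T < c * operator_norm X qX qY T"
  proof (intro allI impI)
    fix c :: real
    assume c: "2 powr (1 - 1 / \<gamma>) < c"
    let ?q = "symmetrization \<gamma> mixed_part"
    have "0 < c"
      using c powr_ge_zero[of 2 "1 - 1 / \<gamma>"] by linarith
    have "entropy_number 1 plane l1_norm plane ?q diagonal_map \<le> 2"
      by (rule entropy_number_diagonal[OF assms])
    \<comment> \<open>The radius 2 is the critical constant times the lower bound for the operator
      norm, so any larger \<open>c\<close> makes the next inequality strict.\<close>
    also have "2 = 2 powr (1 - 1 / \<gamma>) * 2 powr (1 / \<gamma>)"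
      by (simp flip: powr_add)
    also have "\<dots> < c * 2 powr (1 / \<gamma>)"
      using c by simp
    also have "\<dots> \<le> c * operator_norm plane l1_norm ?q diagonal_map"
      using operator_norm_diagonal[OF \<open>0 < \<gamma>\<close>] \<open>0 < c\<close> by simp
    finally show "\<exists>(X :: ambient set) qX (Y :: ambient set) qY T.
        quasi_Banach X qX \<and> gamma_Banach \<gamma> Y qY \<and> bounded_operator X qX Y qY T \<and>
        entropy_number 1 X qX Y qY T < c * operator_norm X qX qY T"
      using quasi_Banach_l1 gamma_Banach_mixed[OF assms] bounded_operator_diagonal[OF \<open>0 < \<gamma>\<close>]
      by blast
  qed
qed

end
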